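(* The measurement $Z_0$ gives $(\epsilon_0,\delta_0)$-differential privacy to the customers, where $$\epsilon_0=\frac{\Delta K}{\sigma_0}+O\left(\frac{\epsilon_0}{K}\right),\qquad \epsilon_0\to 0,$$ and $K=K(\delta_0)=Q^{-1}(\delta_0)$.
   Context: Here $Q(x):=\frac{1}{\sqrt{2\pi}}\int_x^\infty e^{-u^2/2}\,du$ is the Gaussian tail function and $Q^{-1}$ its inverse. Setting: a power distribution line has $N$ locations; at each location $j$ several customers are connected in parallel, drawing a total load current with realized value $l_j$. The operator measures the total current supplied to the line with additive noise, $Z_0=q_0+W_0$, where $q_0=l_1+l_2+\dots+l_N$ is the query and $W_0\sim\mathcal N(0,\sigma_0^2)$ is zero-mean Gaussian measurement noise with standard deviation $\sigma_0$. The number $\Delta$ is a uniform bound on the difference between the maximum and minimum load current of a single customer. Two load patterns are adjacent if one is obtained from the other when a single customer at an arbitrary location $j$ changes his or her load, so that the load at that location goes from $l_j$ to $l_j'$, with $|l_j-l_j'|\le\Delta$, all other loads being unchanged. The sensitivity of the query $q_0$, i.e. the supremum of $|q_0(l)-q_0(l')|$ over adjacent load patterns $l,l'$, is $\Delta$. A measurement $M(d,W)\in\mathbb R$ of data $d$, with $W$ a random variable, is $(\epsilon,\delta)$-differentially private (with $\epsilon\ge 0$, $\delta\ge 0$) if for all adjacent data $d,d'$ and all possible events $E\subseteq\mathrm{Supp}(M(d,W))\cup\mathrm{Supp}(M(d',W))$, $$\Pr[M(d,W)\in E]\le e^{\epsilon}\,\Pr[M(d',W)\in E]+\delta.$$ That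 $Z_0$ gives $(\epsilon_0,\delta_0)$-differential privacy to the customers means that this holds for $M=Z_0$, with the load pattern as data and the adjacency relation above. *)

theory Defs
  imports "HOL-Probability.Probability" "HOL-Library.Landau_Symbols"
begin

definition Q :: "real \<Rightarrow> real" where
  "Q x = 1 / sqrt (2 * pi) * (LBINT u:{x..}. exp (- u\<^sup>2 / 2))"

text \<open>Only meaningful on the range of \<^const>\<open>Q\<close>, the open interval from 0 to 1.\<close>

definition Qinv :: "real \<Rightarrow> real" where
  "Qinv = inv Q"

definition rv_support :: "'w measure \<Rightarrow> ('w \<Rightarrow> real) \<Rightarrow> real set" where
  "rv_support P X = {x. \<forall>U. open U \<longrightarrow> x \<in> U \<longrightarrow> \<P>(\<omega> in P. X \<omega> \<in> U) > 0}"

definition differentially_private ::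
  "('d \<Rightarrow> 'd \<Rightarrow> bool) \<Rightarrow> 'w measure \<Rightarrow> ('d \<Rightarrow> 'v \<Rightarrow> real) \<Rightarrow> ('w \<Rightarrow> 'v) \<Rightarrow> real \<Rightarrow> real \<Rightarrow> bool" where
  "differentially_private adj P M W \<epsilon> \<delta> \<longleftrightarrow>
     0 \<le> \<epsilon> \<and> 0 \<le> \<delta> \<and>
     (\<forall>d d'. adj d d' \<longrightarrow>
       (\<forall>E \<in> sets borel.
         E \<subseteq> rv_support P (\<lambda>\<omega>. M d (W \<omega>)) \<union> rv_support P (\<lambda>\<omega>. M d' (W \<omega>)) \<longrightarrow>
         \<P>(\<omega> in P. M d (W \<omega>) \<in> E) \<le> exp \<epsilon> * \<P>(\<omega> in P. M d' (W \<omega>) \<in> E) + \<delta>))"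

text \<open>A load pattern on a line with \<open>N\<close> locations is a function of which only the values at
  \<open>1, \<dots>, N\<close> matter.\<close>

definition adjacent_loads :: "nat \<Rightarrow> real \<Rightarrow> (nat \<Rightarrow> real) \<Rightarrow> (nat \<Rightarrow> real) \<Rightarrow> bool" where
  "adjacent_loads N \<Delta> l l' \<longleftrightarrow>
     (\<exists>j\<in>{1..N}. \<bar>l j - l' j\<bar> \<le> \<Delta> \<and> (\<forall>i\<in>{1..N} - {j}. l i = l' i))"

definition total_load :: "nat \<Rightarrow> (nat \<Rightarrow> real) \<Rightarrow> real" where
  "total_load N l = (\<Sum>j = 1..N. l j)"

definition Z\<^sub>0 :: "nat \<Rightarrow> (nat \<Rightarrow> real) \<Rightarrow> real \<Rightarrow> real" where
  "Z\<^sub>0 N l w = total_load N l + w"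

text \<open>The regime in which a function \<open>f\<close> of the parameters tends to 0 while the parameters
  stay in \<open>S\<close>; no other restriction is put on how they vary.\<close>

definition vanishing_within :: "('p \<Rightarrow> real) \<Rightarrow> 'p set \<Rightarrow> 'p filter" where
  "vanishing_within f S = inf (filtercomap f (nhds 0)) (principal S)"

text \<open>Parameter triples (Delta, sigma, delta) with delta at most \<open>c\<close>. The value 1/2 is left out
  because \<^const>\<open>Qinv\<close> vanishes there and is used as a divisor. The cut-off \<open>c < 1\<close> is only felt
  above 1/2: as delta tends to 1, \<^const>\<open>Qinv\<close> tends to minus infinity, and no nonnegative
  epsilon is within a uniform multiple of epsilon / K of the then negative leading
  term Delta K / sigma.\<close>

definition param_region :: "real \<Rightarrow> (real \<times> real \<times> real) set" where
  "param_region c = {(\<Delta>, \<sigma>, \<delta>). 0 \<le> \<Delta> \<and> 0 < \<sigma> \<and> 0 < \<delta> \<and> \<delta> \<le> c \<and> \<delta> \<noteq> 1 / 2}"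

end

theory Submission
  imports Defs
begin

text \<open>Write \<open>s = \<Delta> / \<sigma>\<close> and \<open>K\<close> for the inverse tail at \<open>\<delta>\<close>. Two adjacent load patterns shift the mean of
  the Gaussian measurement by some \<open>t\<close> with \<open>\<bar>t\<bar> \<le> \<Delta>\<close>. The logarithm of the ratio of the two shifted
  densities is affine in the noise \<open>w\<close>, namely \<open>(2 t w + t\<^sup>2) / (2 \<sigma>\<^sup>2)\<close>, so for \<open>t \<noteq> 0\<close> it
  exceeds \<open>\<epsilon>\<close> only on a half line, the one where \<open>w\<close> in the direction of \<open>t\<close> exceeds \<open>\<sigma>\<^sup>2 \<epsilon> / \<bar>t\<bar> - \<bar>t\<bar> / 2\<close>. Outside this
  half line the densities compare pointwise, and \<open>density_domination\<close> turns this into a comparison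
  of probabilities whose only loss is the probability of the half line. That is at most \<open>\<delta>\<close> as
  soon as the half line starts at \<open>\<sigma> K\<close> or later, and for \<open>K \<ge> 0\<close> this is guaranteed by
  \<open>\<epsilon> = s K + s\<^sup>2 / 2\<close>; see \<open>gaussian_shift_privacy\<close>.

  The choice made here is \<open>\<epsilon> = s \<bar>K\<bar> + s\<^sup>2 / 2\<close>, which also serves \<open>\<delta> > 1/2\<close>, where \<open>K < 0\<close>
  and the formula without absolute value could be negative. If \<open>\<epsilon> < 1/2\<close> then \<open>s < 1\<close>, so for \<open>K > 0\<close> the error
  \<open>s\<^sup>2 / 2\<close> is at most \<open>s\<close>, hence at most \<open>\<epsilon> / K\<close>. For \<open>K < 0\<close> the error is at most \<open>2 \<epsilon>\<close>, and
  the cut-off \<open>\<delta> \<le> c < 1\<close> keeps \<open>\<bar>K\<bar>\<close> bounded, so that \<open>\<epsilon>\<close> is at most a constant multiple of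
  \<open>\<epsilon> / \<bar>K\<bar>\<close> (\<open>leading_term_error\<close>).\<close>

section \<open>The Gaussian tail function\<close>

lemma Q_eq_measure: "Q x = measure (density lborel std_normal_density) {x..}"
proof -
  let ?G = "density lborel std_normal_density"
  interpret G: prob_space ?G by (rule prob_space_normal_density) simp
  have int: "integrable lborel (\<lambda>u. indicator {x..} u * std_normal_density u)"
    using integrable_mult_indicator[of "{x..}" lborel std_normal_density] by simp
  have "emeasure ?G {x..} = (\<integral>\<^sup>+u. ennreal (indicator {x..} u * std_normal_density u) \<partial>lborel)"
    by (subst emeasure_density) (auto intro!: nn_integral_cong split: split_indicator)
  also have "\<dots> = ennreal (\<integral>u. indicator {x..} u * std_normal_density u \<partial>lborel)"
    by (rule nn_integral_eq_integral[OF int]) simp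
  finally have "measure ?G {x..} = (\<integral>u. indicator {x..} u * std_normal_density u \<partial>lborel)"
    by (intro measure_eq_emeasure_eq_ennreal integral_nonneg_AE) auto
  also have "\<dots> = (\<integral>u. 1 / sqrt (2 * pi) * (indicator {x..} u * exp (- u\<^sup>2 / 2)) \<partial>lborel)"
    by (simp add: normal_density_def ac_simps)
  also have "\<dots> = Q x"
    by (simp add: Q_def set_lebesgue_integral_def)
  finally show ?thesis by simp
qed

lemma distributed_prob:
  assumes "prob_space P" "distributed P lborel X f" "A \<in> sets borel"
  shows "\<P>(\<omega> in P. X \<omega> \<in> A) = measure (density lborel f) A"
proof -
  have "X \<in> measurable P lborel" using assms(2) by (simp add: distributed_def)
  then have "measure (distr P lborel X) A = measure P (X -` A \<inter> space P)"
    using assms(3) by (simp add: measure_distr)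
  then show ?thesis
    using assms(2) by (simp add: distributed_def vimage_def Int_def conj_commute)
qed

lemma normal_prob_ge_eq_Q:
  assumes "prob_space P" "distributed P lborel W (normal_density 0 \<sigma>)" "0 < \<sigma>"
  shows "\<P>(\<omega> in P. \<sigma> * x \<le> W \<omega>) = Q x"
proof -
  have "distributed P lborel (\<lambda>\<omega>. (W \<omega> - 0) / \<sigma>) std_normal_density"
    using assms prob_space.normal_standard_normal_convert by blast
  from distributed_prob[OF assms(1) this, of "{x..}"] show ?thesis
    using assms(3) by (simp add: Q_eq_measure field_simps)
qed

lemma normal_prob_le_eq_Q:
  assumes "prob_space P" "distributed P lborel W (normal_density 0 \<sigma>)" "0 < \<sigma>"
  shows "\<P>(\<omega> in P. W \<omega> \<le> - (\<sigma> * x)) = Q x"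
proof -
  have "distributed P lborel (\<lambda>\<omega>. 0 + (-1) * W \<omega>) (normal_density (0 + (-1) * 0) (\<bar>-1\<bar> * \<sigma>))"
    using assms by (intro prob_space.normal_density_affine) auto
  then have "distributed P lborel (\<lambda>\<omega>. - W \<omega>) (normal_density 0 \<sigma>)" by simp
  from normal_prob_ge_eq_Q[OF assms(1) this assms(3), of x] show ?thesis
    by (simp add: le_minus_iff)
qed

lemma distributed_id_std_normal:
  "distributed (density lborel std_normal_density) lborel (\<lambda>x. x) (normal_density 0 1)"
  by (simp add: distributed_def distr_id2)

lemma Q_eq_cdf: "Q x = cdf (density lborel std_normal_density) (- x)"
  using normal_prob_le_eq_Q[OF prob_space_normal_density distributed_id_std_normal, of x]
  by (simp add: cdf_def atMost_def)

lemma Q_antimono: "x \<le> y \<Longrightarrow> Q y \<le> Q x"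
proof -
  interpret real_distribution "density lborel std_normal_density"
    by (simp add: real_distribution_def real_distribution_axioms_def prob_space_normal_density)
  show "x \<le> y \<Longrightarrow> Q y \<le> Q x"
    unfolding Q_eq_cdf by (rule cdf_nondecreasing) simp
qed

lemma measure_std_normal_singleton: "measure (density lborel std_normal_density) {x} = 0"
proof -
  have "AE y in lborel. y \<noteq> x" by (rule AE_lborel_singleton)
  then have "emeasure (density lborel std_normal_density) {x} = 0"
    by (auto simp: emeasure_density nn_integral_0_iff_AE split: split_indicator)
  then show ?thesis by (simp add: measure_def)
qed

lemma Q_zero: "Q 0 = 1 / 2"
proof -
  let ?G = "density lborel std_normal_density"
  interpret G: prob_space ?G by (rule prob_space_normal_density) simp
  have "Q 0 + Q 0 = measure ?G {0..} + measure ?G {..0}"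
    using Q_eq_measure[of 0] Q_eq_cdf[of 0] by (simp add: cdf_def)
  also have "\<dots> = measure ?G ({0..} \<union> {..0}) + measure ?G ({0..} \<inter> {..0})"
    by (subst measure_Un3) (auto simp: fmeasurable_def G.emeasure_finite less_top[symmetric])
  also have "{0..} \<union> {..0} = space ?G" by auto
  also have "{0..} \<inter> {..0} = {0::real}" by auto
  finally show ?thesis using G.prob_space measure_std_normal_singleton[of 0] by simp
qed

text \<open>Surjectivity onto the open unit interval, by the intermediate value theorem: the Gaussian
  distribution has no atoms, so its distribution function is continuous.\<close>

lemma Q_Qinv:
  assumes "0 < \<delta>" "\<delta> < 1"
  shows "Q (Qinv \<delta>) = \<delta>"
proof -
  let ?G = "density lborel std_normal_density"
  interpret real_distribution ?G
    by (simp add: real_distribution_def real_distribution_axioms_def prob_space_normal_density)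
  have "eventually (\<lambda>x. cdf ?G x < \<delta>) at_bot"
    using order_tendstoD(2)[OF cdf_lim_at_bot] assms by simp
  then obtain a where a: "\<And>x. x \<le> a \<Longrightarrow> cdf ?G x < \<delta>"
    by (auto simp: eventually_at_bot_linorder)
  have "eventually (\<lambda>x. \<delta> < cdf ?G x) at_top"
    using order_tendstoD(1)[OF cdf_lim_at_top_prob] assms by simp
  then obtain b where b: "\<And>x. b \<le> x \<Longrightarrow> \<delta> < cdf ?G x"
    by (auto simp: eventually_at_top_linorder)
  have "\<exists>x. a \<le> x \<and> x \<le> max a b \<and> cdf ?G x = \<delta>"
    using a[of a] b[of "max a b"] isCont_cdf measure_std_normal_singleton
    by (intro IVT) (auto intro: less_imp_le)
  then obtain x where "cdf ?G x = \<delta>" by blast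
  then have "Q (- x) = \<delta>" by (simp add: Q_eq_cdf)
  then show ?thesis
    unfolding Qinv_def by (intro f_inv_into_f) auto
qed

lemma Qinv_antimono:
  assumes "0 < \<delta>" "\<delta> \<le> c" "c < 1"
  shows "Qinv c \<le> Qinv \<delta>"
proof (rule ccontr)
  assume "\<not> Qinv c \<le> Qinv \<delta>"
  moreover from this have "Q (Qinv c) \<le> Q (Qinv \<delta>)" by (intro Q_antimono) simp
  ultimately show False using assms by (simp add: Q_Qinv)
qed

section \<open>Privacy of a Gaussian measurement\<close>

text \<open>An event is split along the set \<open>B\<close> where the density ratio is out of control; only the part
  inside \<open>B\<close> is not covered by the pointwise comparison of densities.\<close>

lemma density_domination:
  fixes f g :: "real \<Rightarrow> real"
  assumes P: "prob_space P"
    and X: "distributed P lborel X f" and Y: "distributed P lborel Y g"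
    and le: "\<And>x. x \<notin> B \<Longrightarrow> f x \<le> c * g x"
    and [measurable]: "B \<in> sets borel" "E \<in> sets borel" and c: "0 \<le> c"
  shows "\<P>(\<omega> in P. X \<omega> \<in> E) \<le> c * \<P>(\<omega> in P. Y \<omega> \<in> E) + \<P>(\<omega> in P. X \<omega> \<in> B)"
proof -
  interpret prob_space P by (rule P)
  have [measurable]: "X \<in> borel_measurable P" "Y \<in> borel_measurable P"
    "(\<lambda>x. ennreal (g x)) \<in> borel_measurable borel"
    using X Y by (auto simp: distributed_def)
  have "emeasure P (X -` (E - B) \<inter> space P) = (\<integral>\<^sup>+x. ennreal (f x) * indicator (E - B) x \<partial>lborel)"
    using X by (rule distributed_emeasure) simp
  also have "\<dots> \<le> (\<integral>\<^sup>+x. ennreal c * (ennreal (g x) * indicator E x) \<partial>lborel)"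
    using le c by (intro nn_integral_mono)
      (auto split: split_indicator simp: ennreal_mult'[symmetric] intro!: ennreal_leI)
  also have "\<dots> = ennreal c * (\<integral>\<^sup>+x. ennreal (g x) * indicator E x \<partial>lborel)"
    by (rule nn_integral_cmult) simp
  also have "(\<integral>\<^sup>+x. ennreal (g x) * indicator E x \<partial>lborel) = emeasure P (Y -` E \<inter> space P)"
    using Y by (rule distributed_emeasure[symmetric]) simp
  finally have "prob (X -` (E - B) \<inter> space P) \<le> c * prob (Y -` E \<inter> space P)"
    using c by (simp add: emeasure_eq_measure ennreal_mult'[symmetric])
  moreover have "prob (X -` E \<inter> space P)
      \<le> prob (X -` (E - B) \<inter> space P) + prob (X -` B \<inter> space P)"
    by (rule order_trans[OF finite_measure_mono measure_subadditive]) auto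
  ultimately show ?thesis
    by (simp add: vimage_def Int_def conj_commute)
qed

text \<open>With \<open>x = m + w\<close> and \<open>t = m - m'\<close> the hypothesis says that the log ratio of the densities,
  \<open>(2 w t + t\<^sup>2) / (2 \<sigma>\<^sup>2)\<close>, is at most \<open>\<epsilon>\<close>.\<close>

lemma normal_density_shift_le:
  assumes "0 < \<sigma>" and "2 * (x - m) * (m - m') + (m - m')\<^sup>2 \<le> 2 * \<sigma>\<^sup>2 * \<epsilon>"
  shows "normal_density m \<sigma> x \<le> exp \<epsilon> * normal_density m' \<sigma> x"
proof -
  have "- (x - m)\<^sup>2 \<le> 2 * \<sigma>\<^sup>2 * \<epsilon> - (x - m')\<^sup>2"
    using assms(2) by (simp add: power2_eq_square algebra_simps)
  then have "- (x - m)\<^sup>2 / (2 * \<sigma>\<^sup>2) \<le> \<epsilon> + - (x - m')\<^sup>2 / (2 * \<sigma>\<^sup>2)"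
    using assms(1) by (simp add: field_simps)
  then have "exp (- (x - m)\<^sup>2 / (2 * \<sigma>\<^sup>2)) \<le> exp \<epsilon> * exp (- (x - m')\<^sup>2 / (2 * \<sigma>\<^sup>2))"
    by (simp add: exp_add[symmetric])
  then show ?thesis
    using mult_left_mono[of "exp (- (x - m)\<^sup>2 / (2 * \<sigma>\<^sup>2))" _ "1 / sqrt (2 * pi * \<sigma>\<^sup>2)"]
    by (simp add: normal_density_def mult.left_commute)
qed

text \<open>The loss grows with the component \<open>sgn t * w\<close> of the noise along the shift \<open>t\<close>, so among
  the admitted \<open>w\<close> it is largest where that component equals \<open>\<sigma> K\<close>. Replacing \<open>K\<close> by its absolute value makes the resulting bound
  monotone in \<open>\<bar>t\<bar>\<close>, so that \<open>\<bar>t\<bar>\<close> can be replaced by \<open>\<Delta>\<close>.\<close>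

lemma privacy_loss_bound:
  fixes \<Delta> \<sigma> K t w :: real
  assumes "0 < \<sigma>" "\<bar>t\<bar> \<le> \<Delta>" "sgn t * w \<le> \<sigma> * K"
  shows "2 * w * t + t\<^sup>2 \<le> 2 * \<sigma>\<^sup>2 * (\<Delta> / \<sigma> * \<bar>K\<bar> + (\<Delta> / \<sigma>)\<^sup>2 / 2)"
proof -
  have "w * t = \<bar>t\<bar> * (sgn t * w)" by (simp add: abs_sgn mult.assoc)
  also have "\<dots> \<le> \<bar>t\<bar> * (\<sigma> * K)" using assms(3) by (intro mult_left_mono) auto
  also have "\<dots> \<le> \<bar>t\<bar> * (\<sigma> * \<bar>K\<bar>)" using assms(1) by (intro mult_left_mono) auto
  also have "\<dots> \<le> \<Delta> * (\<sigma> * \<bar>K\<bar>)" using assms(1,2) by (intro mult_right_mono) auto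
  finally have "w * t \<le> \<Delta> * (\<sigma> * \<bar>K\<bar>)" .
  moreover have "t\<^sup>2 \<le> \<Delta>\<^sup>2" using assms(2) by (simp add: abs_le_square_iff[symmetric])
  moreover have "2 * \<sigma>\<^sup>2 * (\<Delta> / \<sigma> * \<bar>K\<bar> + (\<Delta> / \<sigma>)\<^sup>2 / 2) = 2 * (\<Delta> * (\<sigma> * \<bar>K\<bar>)) + \<Delta>\<^sup>2"
    using assms(1) by (simp add: field_simps power2_eq_square)
  ultimately show ?thesis by (simp add: mult.commute)
qed

lemma gaussian_shift_privacy:
  assumes P: "prob_space P" and W: "distributed P lborel W (normal_density 0 \<sigma>)"
    and \<sigma>: "0 < \<sigma>" and \<Delta>: "\<bar>m - m'\<bar> \<le> \<Delta>" and E: "E \<in> sets borel"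
  shows "\<P>(\<omega> in P. m + W \<omega> \<in> E)
    \<le> exp (\<Delta> / \<sigma> * \<bar>K\<bar> + (\<Delta> / \<sigma>)\<^sup>2 / 2) * \<P>(\<omega> in P. m' + W \<omega> \<in> E) + Q K"
proof -
  let ?\<epsilon> = "\<Delta> / \<sigma> * \<bar>K\<bar> + (\<Delta> / \<sigma>)\<^sup>2 / 2"
  have shift: "distributed P lborel (\<lambda>\<omega>. a + W \<omega>) (normal_density a \<sigma>)" for a
    using prob_space.normal_density_affine[OF P W \<sigma>, of 1 a] by simp
  \<comment> \<open>The half line on which the noise exceeds \<open>\<sigma> K\<close> in the direction of the shift \<open>m - m'\<close>. For a zero
    shift the loss is zero everywhere and either direction will do.\<close>
  define B where "B = (if m' \<le> m then {m + \<sigma> * K..} else {..m - \<sigma> * K})"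
  have "normal_density m \<sigma> x \<le> exp ?\<epsilon> * normal_density m' \<sigma> x" if "x \<notin> B" for x
  proof (rule normal_density_shift_le[OF \<sigma>])
    show "2 * (x - m) * (m - m') + (m - m')\<^sup>2 \<le> 2 * \<sigma>\<^sup>2 * ?\<epsilon>"
    proof (cases "m = m'")
      case True
      then show ?thesis using \<Delta> \<sigma> by simp
    next
      case False
      with that have "sgn (m - m') * (x - m) \<le> \<sigma> * K"
        by (auto simp: B_def sgn_if split: if_splits)
      then show ?thesis by (rule privacy_loss_bound[OF \<sigma> \<Delta>])
    qed
  qed
  moreover have "B \<in> sets borel" by (simp add: B_def)
  ultimately have dom: "\<P>(\<omega> in P. m + W \<omega> \<in> E)
      \<le> exp ?\<epsilon> * \<P>(\<omega> in P. m' + W \<omega> \<in> E) + \<P>(\<omega> in P. m + W \<omega> \<in> B)"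
    by (intro density_domination[OF P shift shift]) (auto simp: E)
  have "(m + w \<in> B) = (if m' \<le> m then \<sigma> * K \<le> w else w \<le> - (\<sigma> * K))" for w
    by (auto simp: B_def)
  then have "\<P>(\<omega> in P. m + W \<omega> \<in> B) = Q K"
    using normal_prob_ge_eq_Q[OF P W \<sigma>, of K] normal_prob_le_eq_Q[OF P W \<sigma>, of K]
    by (cases "m' \<le> m") simp_all
  with dom show ?thesis by simp
qed

section \<open>The aggregate load measurement\<close>

lemma adjacent_total_load:
  assumes "adjacent_loads N \<Delta> l l'"
  shows "\<bar>total_load N l - total_load N l'\<bar> \<le> \<Delta>"
proof -
  from assms obtain j where j: "j \<in> {1..N}" "\<bar>l j - l' j\<bar> \<le> \<Delta>"
      "\<And>i. i \<in> {1..N} - {j} \<Longrightarrow> l i = l' i"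
    unfolding adjacent_loads_def by blast
  have "(\<Sum>i\<in>{1..N} - {j}. l i) = (\<Sum>i\<in>{1..N} - {j}. l' i)"
    using j(3) by (rule sum.cong[OF refl])
  then show ?thesis
    using j(1,2) unfolding total_load_def by (simp add: sum.remove[of _ j])
qed

text \<open>The absolute value keeps this nonnegative, and a valid privacy parameter, also when \<open>\<delta> > 1/2\<close>
  makes the inverse tail negative.\<close>

definition eps_gauss :: "real \<times> real \<times> real \<Rightarrow> real" where
  "eps_gauss = (\<lambda>(\<Delta>, \<sigma>, \<delta>). \<Delta> / \<sigma> * \<bar>Qinv \<delta>\<bar> + (\<Delta> / \<sigma>)\<^sup>2 / 2)"

text \<open>For positive \<open>K\<close> the error is quadratic in \<open>s\<close> while \<open>\<epsilon> / K\<close> dominates the linear term, with a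
  constant independent of \<open>K\<close>. For negative \<open>K\<close> the error is of the order of \<open>\<epsilon>\<close> itself, and
  the constant has to absorb a factor \<open>\<bar>K\<bar> \<le> k\<close>.\<close>

lemma leading_term_error:
  fixes s K k :: real
  assumes s: "0 \<le> s" and K: "K \<noteq> 0" "- k \<le> K" and k: "0 \<le> k"
    and small: "s * \<bar>K\<bar> + s\<^sup>2 / 2 < 1 / 2"
  shows "\<bar>s * \<bar>K\<bar> + s\<^sup>2 / 2 - s * K\<bar> \<le> (1 + 2 * k) * \<bar>(s * \<bar>K\<bar> + s\<^sup>2 / 2) / K\<bar>"
proof -
  let ?\<epsilon> = "s * \<bar>K\<bar> + s\<^sup>2 / 2"
  have nn: "0 \<le> s * \<bar>K\<bar>" "0 \<le> ?\<epsilon>" using s by auto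
  have quot: "\<bar>?\<epsilon> / K\<bar> = ?\<epsilon> / \<bar>K\<bar>" using nn by (simp add: abs_divide)
  have quot_nn: "0 \<le> ?\<epsilon> / \<bar>K\<bar>" using nn(2) by (rule divide_nonneg_nonneg) simp
  show ?thesis
  proof (cases "0 < K")
    case True
    have "s\<^sup>2 < 1" using small nn(1) by linarith
    then have "s \<le> 1" using s by (simp add: power2_less_1_iff abs_square_less_1)
    then have "s\<^sup>2 / 2 \<le> s" using s mult_left_le[of s s] by (simp add: power2_eq_square)
    also have "s \<le> ?\<epsilon> / K" using True by (simp add: field_simps)
    also have "\<dots> \<le> (1 + 2 * k) * (?\<epsilon> / K)"
      using True k nn mult_right_mono[of 1 "1 + 2 * k" "?\<epsilon> / K"] by simp
    finally show ?thesis using True s by (simp add: quot)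
  next
    case False
    have "s * K = - (s * \<bar>K\<bar>)" using False by simp
    then have "\<bar>?\<epsilon> - s * K\<bar> = 2 * (s * \<bar>K\<bar>) + s\<^sup>2 / 2"
      using nn zero_le_power2[of s] by linarith
    also have "\<dots> \<le> 2 * (\<bar>K\<bar> * (?\<epsilon> / \<bar>K\<bar>))" using K by simp
    also have "\<dots> \<le> 2 * (k * (?\<epsilon> / \<bar>K\<bar>))"
      using False K quot_nn by (intro mult_left_mono mult_right_mono) linarith+
    also have "\<dots> \<le> (1 + 2 * k) * (?\<epsilon> / \<bar>K\<bar>)"
      using quot_nn by (simp only: distrib_right)
    finally show ?thesis unfolding quot .
  qed
qed

lemma eps_gauss_bigo:
  assumes "c < 1"
  shows "(\<lambda>(\<Delta>, \<sigma>, \<delta>). eps_gauss (\<Delta>, \<sigma>, \<delta>) - \<Delta> * Qinv \<delta> / \<sigma>)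
    \<in> O[vanishing_within eps_gauss (param_region c)](\<lambda>(\<Delta>, \<sigma>, \<delta>). eps_gauss (\<Delta>, \<sigma>, \<delta>) / Qinv \<delta>)"
proof -
  have near: "eventually (\<lambda>p. \<bar>eps_gauss p\<bar> < 1 / 2) (filtercomap eps_gauss (nhds 0))"
    by (rule eventually_filtercomapI[of "\<lambda>e. \<bar>e\<bar> < 1 / 2"])
       (auto simp: eventually_nhds_metric dist_real_def intro!: exI[of _ "1 / 2"])
  have bound: "\<bar>eps_gauss (\<Delta>, \<sigma>, \<delta>) - \<Delta> * Qinv \<delta> / \<sigma>\<bar>
      \<le> (1 + 2 * \<bar>Qinv c\<bar>) * \<bar>eps_gauss (\<Delta>, \<sigma>, \<delta>) / Qinv \<delta>\<bar>"
    if small: "\<bar>eps_gauss (\<Delta>, \<sigma>, \<delta>)\<bar> < 1 / 2" and R: "(\<Delta>, \<sigma>, \<delta>) \<in> param_region c" for \<Delta> \<sigma> \<delta>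
  proof -
    have \<delta>: "0 < \<delta>" "\<delta> \<le> c" "\<delta> \<noteq> 1 / 2" and "0 \<le> \<Delta>" "0 < \<sigma>"
      using R by (auto simp: param_region_def)
    moreover have "Qinv \<delta> \<noteq> 0" using Q_Qinv[of \<delta>] Q_zero \<delta> assms by auto
    moreover have "- \<bar>Qinv c\<bar> \<le> Qinv \<delta>" using Qinv_antimono[OF \<delta>(1,2) assms] by linarith
    ultimately show ?thesis
      using leading_term_error[of "\<Delta> / \<sigma>" "Qinv \<delta>" "\<bar>Qinv c\<bar>"] small
      by (simp add: eps_gauss_def)
  qed
  show ?thesis
    unfolding vanishing_within_def
    by (rule bigoI[where c = "1 + 2 * \<bar>Qinv c\<bar>"], unfold eventually_inf_principal,
        rule eventually_mono[OF near]) (use bound in auto)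
qed

lemma eps_gauss_differentially_private:
  assumes "0 \<le> \<Delta>" "0 < \<sigma>" "0 < \<delta>" "\<delta> < 1" "prob_space P"
    and "distributed P lborel W (normal_density 0 \<sigma>)"
  shows "differentially_private (adjacent_loads N \<Delta>) P (Z\<^sub>0 N) W (eps_gauss (\<Delta>, \<sigma>, \<delta>)) \<delta>"
  unfolding differentially_private_def
proof (intro conjI allI ballI impI)
  show "0 \<le> eps_gauss (\<Delta>, \<sigma>, \<delta>)" using assms by (simp add: eps_gauss_def)
  show "0 \<le> \<delta>" using assms by simp
next
  fix l l' :: "nat \<Rightarrow> real" and E :: "real set"
  assume "adjacent_loads N \<Delta> l l'" and "E \<in> sets borel"
  then show "\<P>(\<omega> in P. Z\<^sub>0 N l (W \<omega>) \<in> E)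
      \<le> exp (eps_gauss (\<Delta>, \<sigma>, \<delta>)) * \<P>(\<omega> in P. Z\<^sub>0 N l' (W \<omega>) \<in> E) + \<delta>"
    using gaussian_shift_privacy[OF assms(5,6,2) adjacent_total_load, of N \<Delta> l l' E "Qinv \<delta>"]
      assms(3,4)
    by (simp add: Z\<^sub>0_def eps_gauss_def Q_Qinv)
qed

lemma eps_gauss_tendsto_0: "((\<lambda>\<sigma>. eps_gauss (\<Delta>, \<sigma>, \<delta>)) \<longlongrightarrow> 0) at_top"
proof -
  have s: "((\<lambda>\<sigma>. \<Delta> / \<sigma>) \<longlongrightarrow> 0) at_top"
    by (rule tendsto_divide_0[OF tendsto_const filterlim_at_top_imp_at_infinity[OF filterlim_ident]])
  have "((\<lambda>\<sigma>. \<Delta> / \<sigma> * \<bar>Qinv \<delta>\<bar> + (\<Delta> / \<sigma>)\<^sup>2 / 2) \<longlongrightarrow> 0 * \<bar>Qinv \<delta>\<bar> + 0\<^sup>2 / 2) at_top"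
    by (intro tendsto_intros s) simp
  then show ?thesis by (simp add: eps_gauss_def)
qed

theorem lemma1:
  "\<exists>\<epsilon>\<^sub>0 :: real \<times> real \<times> real \<Rightarrow> real.
     (\<forall>(N::nat) \<Delta> \<sigma>\<^sub>0 \<delta>\<^sub>0 (P :: 'w measure) W\<^sub>0.
        0 \<le> \<Delta> \<longrightarrow> 0 < \<sigma>\<^sub>0 \<longrightarrow> 0 < \<delta>\<^sub>0 \<longrightarrow> \<delta>\<^sub>0 < 1 \<longrightarrow> prob_space P \<longrightarrow>
        distributed P lborel W\<^sub>0 (normal_density 0 \<sigma>\<^sub>0) \<longrightarrow>
        differentially_private (adjacent_loads N \<Delta>) P (Z\<^sub>0 N) W\<^sub>0 (\<epsilon>\<^sub>0 (\<Delta>, \<sigma>\<^sub>0, \<delta>\<^sub>0)) \<delta>\<^sub>0) \<and>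
     (\<forall>\<Delta> \<delta>\<^sub>0. 0 \<le> \<Delta> \<longrightarrow> 0 < \<delta>\<^sub>0 \<longrightarrow> \<delta>\<^sub>0 < 1 \<longrightarrow>
        ((\<lambda>\<sigma>\<^sub>0. \<epsilon>\<^sub>0 (\<Delta>, \<sigma>\<^sub>0, \<delta>\<^sub>0)) \<longlongrightarrow> 0) at_top) \<and>
     (\<forall>c<1.
        (\<lambda>(\<Delta>, \<sigma>\<^sub>0, \<delta>\<^sub>0). \<epsilon>\<^sub>0 (\<Delta>, \<sigma>\<^sub>0, \<delta>\<^sub>0) - \<Delta> * Qinv \<delta>\<^sub>0 / \<sigma>\<^sub>0)
          \<in> O[vanishing_within \<epsilon>\<^sub>0 (param_region c)](\<lambda>(\<Delta>, \<sigma>\<^sub>0, \<delta>\<^sub>0). \<epsilon>\<^sub>0 (\<Delta>, \<sigma>\<^sub>0, \<delta>\<^sub>0) / Qinv \<delta>\<^sub>0))"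
  using eps_gauss_differentially_private eps_gauss_tendsto_0 eps_gauss_bigo
  by (intro exI[of _ eps_gauss]) blast

end
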